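(* The following inequalities hold: (1) $\mathrm{non}(\mathcal{E}^* )\leq\sup\{\mathfrak{d}(\Pi F,\in^*,\mathcal{S}lm(F,b)): F,b\in\omega^\omega \text{ increasing},\ b\leq F\}$; (2) $\mathrm{non}(\mathcal{E}^* )\geq\min\{\mathfrak{d}(\Pi F,\in^*,\mathcal{S}lm(F,b)): F,b\in\omega^\omega\text{ increasing},\ b\leq F,\ \sum_n\frac{b(n)}{F(n)}<\infty\}$.
   Context: $2^\omega$ is the Cantor space with coordinatewise addition modulo 2 and $\mathcal{E}$ is the $\sigma$-ideal on $2^\omega$ generated by closed Lebesgue measure zero sets. $\mathcal{E}^*=\{X\subseteq 2^\omega:\forall E\in\mathcal{E}\ X+E\neq 2^\omega\}$, where $X+E=\{x+e:x\in X,e\in E\}$, and $\mathrm{non}(\mathcal{E}^* )=\min\{|X|: X\subseteq 2^\omega,\ X\notin\mathcal{E}^*\}$. A function $f\in\omega^\omega$ is increasing if $f(n)<f(n+1)$ for all $n$; we assume $F(n)\geq1$ for all $n$; $b\leq F$ means $b(n)\leq F(n)$ for all $n$. $\Pi F=\prod_{n\in\omega}F(n)=\{x\in\omega^\omega: x(n)<F(n)\text{ for all } n\}$. $\mathcal{S}lm(F,b)$ is the set of functions $S$ with domain $\omega$ such that $S(n)\in[F(n)]^{b(n)}$ (a subset of $F(n)=\{0,\dots,F(n)-1\}$ of size $b(n)$) for every $n$. For $x\in\Pi F$ and $S\in\mathcal{S}lm(F,b)$, $x\in^*S$ means $x(n)\in S(n)$ for all but finitely many $n$. $\mathfrak{d}(\Pi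 F,\in^*,\mathcal{S}lm(F,b))$ is the least size of a family $\mathcal{Z}\subseteq\mathcal{S}lm(F,b)$ such that every $x\in\Pi F$ satisfies $x\in^*S$ for some $S\in\mathcal{Z}$. *)

theory Defs
  imports "HOL-Probability.Probability"
begin

unbundle cardinal_syntax

text \<open>
  Cardinals are represented, as in the library, by relations satisfying \<^const>\<open>Card_order\<close>, so they
  are determined only up to \<open>=o\<close>; this is why a choice operator is used.
\<close>

definition card_Min :: "'a rel set \<Rightarrow> 'a rel" where
  "card_Min R = (SOME r. r \<in> R \<and> (\<forall>s\<in>R. r \<le>o s))"

text \<open>
  The upper bounds range over the cardinals on the fixed type \<open>'a\<close>. This loses nothing: \<open>|UNIV :: 'a set|\<close>
  is an upper bound, and an upper bound on another type is either at least that large or equivalent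
  to a cardinal on \<open>'a\<close>; see \<open>card_Sup_least\<close>.
\<close>

definition card_Sup :: "'a rel set \<Rightarrow> 'a rel" where
  "card_Sup R = (SOME r. Card_order r \<and> (\<forall>s\<in>R. s \<le>o r) \<and>
     (\<forall>t :: 'a rel. Card_order t \<and> (\<forall>s\<in>R. s \<le>o t) \<longrightarrow> r \<le>o t))"

lemma card_Min:
  assumes "R \<noteq> {}" and "\<And>r. r \<in> R \<Longrightarrow> Card_order r"
  shows card_Min_in: "card_Min R \<in> R" and card_Min_le: "s \<in> R \<Longrightarrow> card_Min R \<le>o s"
proof -
  have "\<exists>r. r \<in> R \<and> (\<forall>s\<in>R. r \<le>o s)"
    using exists_minim_Card_order[of R] assms by blast
  then have "card_Min R \<in> R \<and> (\<forall>s\<in>R. card_Min R \<le>o s)"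
    unfolding card_Min_def by (rule someI_ex)
  then show "card_Min R \<in> R" and "s \<in> R \<Longrightarrow> card_Min R \<le>o s" by blast+
qed

lemma Card_order_le_UNIV:
  fixes r :: "'a rel"
  assumes "Card_order r"
  shows "r \<le>o |UNIV :: 'a set|"
  using ordIso_ordLeq_trans[OF ordIso_symmetric[OF card_of_Field_ordIso[OF assms]]
      card_of_mono1[OF subset_UNIV]] .

lemma card_Sup:
  fixes R :: "'a rel set"
  assumes "\<And>r. r \<in> R \<Longrightarrow> Card_order r"
  shows Card_order_card_Sup: "Card_order (card_Sup R)"
    and card_Sup_upper: "s \<in> R \<Longrightarrow> s \<le>o card_Sup R"
    and card_Sup_least: "Card_order (t :: 'b rel) \<Longrightarrow> (\<And>s. s \<in> R \<Longrightarrow> s \<le>o t) \<Longrightarrow> card_Sup R \<le>o t"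
proof -
  let ?U = "{t :: 'a rel. Card_order t \<and> (\<forall>s\<in>R. s \<le>o t)}"
  have U: "|UNIV :: 'a set| \<in> ?U"
    by (intro CollectI conjI ballI card_of_Card_order Card_order_le_UNIV assms)
  then have "\<exists>r\<in>?U. \<forall>t\<in>?U. r \<le>o t"
    by (intro exists_minim_Card_order) blast+
  then have "\<exists>r :: 'a rel. Card_order r \<and> (\<forall>s\<in>R. s \<le>o r) \<and>
     (\<forall>t :: 'a rel. Card_order t \<and> (\<forall>s\<in>R. s \<le>o t) \<longrightarrow> r \<le>o t)" by blast
  then have S: "Card_order (card_Sup R) \<and> (\<forall>s\<in>R. s \<le>o card_Sup R) \<and>
     (\<forall>t :: 'a rel. Card_order t \<and> (\<forall>s\<in>R. s \<le>o t) \<longrightarrow> card_Sup R \<le>o t)"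
    unfolding card_Sup_def by (rule someI_ex)
  then show "Card_order (card_Sup R)" and "s \<in> R \<Longrightarrow> s \<le>o card_Sup R" by blast+
  assume t: "Card_order (t :: 'b rel)" and ub: "\<And>s. s \<in> R \<Longrightarrow> s \<le>o t"
  show "card_Sup R \<le>o t"
  proof (rule ccontr)
    assume "\<not> card_Sup R \<le>o t"
    then have "t <o card_Sup R"
      using t S not_ordLeq_iff_ordLess[of t "card_Sup R"] by (simp add: card_order_on_def)
    then have "t \<le>o |UNIV :: 'a set|"
      using S Card_order_le_UNIV[of "card_Sup R"]
      by (meson ordLeq_transitive ordLess_imp_ordLeq)
    moreover have tF: "|Field t| =o t"
      using t by (rule card_of_Field_ordIso)
    ultimately have "|Field t| \<le>o |UNIV :: 'a set|"
      by (rule ordIso_ordLeq_trans[rotated])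
    then obtain f :: "'b \<Rightarrow> 'a" where f: "inj_on f (Field t)"
      using card_of_ordLeq[of "Field t" "UNIV :: 'a set"] by auto
    then have "|Field t| =o |f ` Field t|"
      using card_of_ordIsoI[OF bij_betw_imageI[OF f refl]] by simp
    then have tf: "t =o |f ` Field t|"
      by (rule ordIso_transitive[OF ordIso_symmetric[OF tF]])
    have "\<forall>s\<in>R. s \<le>o |f ` Field t|"
      by (intro ballI ordLeq_ordIso_trans[OF _ tf] ub)
    then have "card_Sup R \<le>o |f ` Field t|"
      using S card_of_Card_order by blast
    then have "card_Sup R \<le>o t"
      by (rule ordLeq_ordIso_trans[OF _ ordIso_symmetric[OF tf]])
    then show False using \<open>\<not> card_Sup R \<le>o t\<close> by blast
  qed
qed

text \<open>
  The Cantor space is the type \<^typ>\<open>nat \<Rightarrow> bool\<close> with the library's product topology;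
  \<^const>\<open>True\<close> plays the role of 1, so addition modulo 2 is exclusive disjunction.
\<close>

definition cantor_add :: "(nat \<Rightarrow> bool) \<Rightarrow> (nat \<Rightarrow> bool) \<Rightarrow> (nat \<Rightarrow> bool)" where
  "cantor_add x y = (\<lambda>n. x n \<noteq> y n)"

definition cantor_set_add :: "(nat \<Rightarrow> bool) set \<Rightarrow> (nat \<Rightarrow> bool) set \<Rightarrow> (nat \<Rightarrow> bool) set" where
  "cantor_set_add X E = {cantor_add x e | x e. x \<in> X \<and> e \<in> E}"

definition cantor_measure :: "(nat \<Rightarrow> bool) measure" where
  "cantor_measure = (\<Pi>\<^sub>M n\<in>UNIV. measure_pmf (bernoulli_pmf (1/2)))"

instance bool :: second_countable_topology
proof
  show "\<exists>B :: bool set set. countable B \<and> open = generate_topology B"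
    by (intro exI[of _ "range lessThan \<union> range greaterThan"])
       (auto simp: open_bool_def intro!: countable_finite)
qed

lemma sets_cantor_measure: "sets cantor_measure = sets borel"
proof -
  have "sets (borel :: bool measure) = UNIV"
    using sets_borel_eq_count_space[where 'a = bool] by simp
  then have "sets cantor_measure = sets (\<Pi>\<^sub>M n\<in>(UNIV :: nat set). (borel :: bool measure))"
    unfolding cantor_measure_def by (intro sets_PiM_cong) auto
  then show ?thesis by (simp only: sets_PiM_equal_borel)
qed

definition sigma_ideal :: "'a set set \<Rightarrow> bool" where
  "sigma_ideal I \<longleftrightarrow> {} \<in> I \<and> (\<forall>A\<in>I. \<forall>B. B \<subseteq> A \<longrightarrow> B \<in> I) \<and>
     (\<forall>A :: nat \<Rightarrow> 'a set. range A \<subseteq> I \<longrightarrow> (\<Union>n. A n) \<in> I)"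

definition E_ideal :: "(nat \<Rightarrow> bool) set set" where
  "E_ideal = sigma_ideal hull {C. closed C \<and> C \<in> null_sets cantor_measure}"

definition E_star :: "(nat \<Rightarrow> bool) set set" where
  "E_star = {X. \<forall>E\<in>E_ideal. cantor_set_add X E \<noteq> UNIV}"

definition non :: "'a set set \<Rightarrow> 'a rel" where
  "non I = card_Min {card_of X | X. X \<notin> I}"

definition Pi_below :: "(nat \<Rightarrow> nat) \<Rightarrow> (nat \<Rightarrow> nat) set" where
  "Pi_below F = {x. \<forall>n. x n < F n}"

definition Slm :: "(nat \<Rightarrow> nat) \<Rightarrow> (nat \<Rightarrow> nat) \<Rightarrow> (nat \<Rightarrow> nat set) set" where
  "Slm F b = {S. \<forall>n. S n \<subseteq> {..<F n} \<and> card (S n) = b n}"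

definition in_star :: "(nat \<Rightarrow> nat) \<Rightarrow> (nat \<Rightarrow> nat set) \<Rightarrow> bool" (infix \<open>\<in>\<^sup>*\<close> 50) where
  "x \<in>\<^sup>* S \<longleftrightarrow> (\<forall>\<^sub>\<infinity>n. x n \<in> S n)"

definition dominating_number :: "'a set \<Rightarrow> ('a \<Rightarrow> 'b \<Rightarrow> bool) \<Rightarrow> 'b set \<Rightarrow> 'b rel" where
  "dominating_number X R Y = card_Min {card_of Z | Z. Z \<subseteq> Y \<and> (\<forall>x\<in>X. \<exists>y\<in>Z. R x y)}"

end

theory Submission
  imports Defs "HOL-Real_Asymp.Real_Asymp"
begin

text \<open>
  Cut \<open>\<omega>\<close> into intervals \<open>I\<^sub>k = [p k, p (k + 1))\<close> and identify a point of the Cantor space with the sequence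
  of its blocks, a point of \<open>\<Pi>F\<close> for \<open>F k = 2 ^ |I\<^sub>k|\<close>; addition acts blockwise as bitwise exclusive or.

  By compactness, the measure of a closed set is the limit of the densities of its sets of initial
  segments. Hence every \<open>E\<close> in the ideal is contained in some \<open>{y. \<forall>\<^sub>\<infinity>k. y|I\<^sub>k \<in> J\<^sub>k}\<close> with \<open>J\<^sub>k\<close> of density
  \<open>2 ^ -k\<close>, and if \<open>X + E\<close> is everything, then the slaloms \<open>k \<mapsto> x|I\<^sub>k + J\<^sub>k\<close> for \<open>x \<in> X\<close> localize all of
  \<open>\<Pi>F\<close>. This gives (2).

  For (1) a single pair \<open>F k = 4 ^ (k + 1)\<close>, \<open>b k = k + 1\<close> suffices. Take \<open>K\<^sub>k \<subseteq> F k\<close> of density just above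
  \<open>1 / (k + 2)\<close>. If \<open>|S k| = k + 1\<close>, then \<open>|S k| |K\<^sub>k| < F k\<close>, so some translate of \<open>S k\<close> avoids \<open>K\<^sub>k\<close>.
  Since \<open>\<Sum>k. 1 / (k + 2)\<close> diverges, the set of \<open>y\<close> with \<open>y|I\<^sub>k \<notin> K\<^sub>k\<close> for almost all \<open>k\<close> is in the ideal, and
  it is translated onto everything by one point for each slalom of a localizing family.
\<close>

section \<open>Coding finite segments of points by natural numbers\<close>

text \<open>The first coordinate is the least significant bit, so \<open>take_bit\<close> and
  \<open>drop_bit\<close> cut a segment in two and coordinatewise addition becomes
  \<open>xor\<close>.\<close>

definition segment :: "nat \<Rightarrow> nat \<Rightarrow> (nat \<Rightarrow> bool) \<Rightarrow> nat" where
  "segment n l y = (\<Sum>i<l. of_bool (y (n + i)) * 2 ^ i)"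

lemma bit_segment: "bit (segment n l y) i \<longleftrightarrow> i < l \<and> y (n + i)"
proof -
  have "segment n l y = horner_sum of_bool 2 (map (\<lambda>i. y (n + i)) [0..<l])"
    by (simp add: segment_def horner_sum_eq_sum atLeast0LessThan)
  then show ?thesis
    by (auto simp: bit_horner_sum_bit_iff)
qed

lemma segment_less: "segment n l y < 2 ^ l"
proof -
  have "take_bit l (segment n l y) = segment n l y"
    by (rule bit_eqI) (auto simp: bit_take_bit_iff bit_segment)
  then show ?thesis
    by (simp add: take_bit_nat_eq_self_iff)
qed

lemma segment_image_subset: "segment n l ` C \<subseteq> {..<2 ^ l}"
  using segment_less by auto

lemma finite_segment_image: "finite (segment n l ` C)"
  using finite_subset[OF segment_image_subset] by blast

lemma segment_eq_iff: "segment n l x = segment n l y \<longleftrightarrow> (\<forall>i<l. x (n + i) = y (n + i))"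
  by (auto simp: bit_eq_iff bit_segment)

lemma segment_cantor_add: "segment n l (cantor_add x y) = xor (segment n l x) (segment n l y)"
  by (rule bit_eqI) (auto simp: bit_segment bit_xor_iff cantor_add_def)

lemma less_power_bitD: "t < 2 ^ m \<Longrightarrow> bit t i \<Longrightarrow> i < m" for t :: nat
  by (metis bit_take_bit_iff take_bit_nat_eq_self)

lemma xor_less: "s < 2 ^ l \<Longrightarrow> t < 2 ^ l \<Longrightarrow> xor s t < 2 ^ l" for s t :: nat
  by (metis take_bit_nat_eq_self_iff take_bit_xor)

text \<open>A segment is determined by an initial part and the rest. Equality can fail, since
  \<open>C\<close> need not realize every combination of the two.\<close>

lemma card_segment_append:
  "card (segment 0 (n + l) ` C) \<le> card (segment 0 n ` C) * card (segment n l ` C)"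
proof -
  let ?f = "\<lambda>c :: nat. (take_bit n c, drop_bit n c)"
  have "inj_on ?f (segment 0 (n + l) ` C)"
    by (rule inj_onI) (metis bits_ident prod.inject)
  moreover have "?f (segment 0 (n + l) y) = (segment 0 n y, segment n l y)" for y
    by (auto intro!: bit_eqI simp: bit_take_bit_iff bit_drop_bit_eq bit_segment)
  then have "?f ` segment 0 (n + l) ` C \<subseteq> segment 0 n ` C \<times> segment n l ` C"
    by (auto simp del: prod.inject)
  ultimately have "card (segment 0 (n + l) ` C) \<le> card (segment 0 n ` C \<times> segment n l ` C)"
    by (rule card_inj_on_le) (simp add: finite_segment_image)
  then show ?thesis
    by (simp add: card_cartesian_product)
qed

lemma card_segment_tail: "card (segment n l ` C) \<le> card (segment 0 (n + l) ` C)"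
proof -
  have "segment n l y = drop_bit n (segment 0 (n + l) y)" for y
    by (rule bit_eqI) (auto simp: bit_drop_bit_eq bit_segment)
  then have "segment n l ` C = drop_bit n ` segment 0 (n + l) ` C"
    by (simp add: image_image)
  then show ?thesis
    by (simp add: card_image_le finite_segment_image)
qed

lemma interval_partition_unique:
  fixes p :: "nat \<Rightarrow> nat"
  assumes "strict_mono p" "p k \<le> j" "j < p (Suc k)" "p k' \<le> j" "j < p (Suc k')"
  shows "k = k'"
proof -
  have "k < Suc k'" "k' < Suc k"
    using assms strict_mono_less[OF assms(1)] by (metis le_less_trans)+
  then show ?thesis by simp
qed

text \<open>The intervals are disjoint, so the blocks can be prescribed independently.\<close>

lemma exists_segments:
  assumes "strict_mono p" "\<And>k. z k < 2 ^ (p (Suc k) - p k)"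
  obtains y where "\<And>k. segment (p k) (p (Suc k) - p k) y = z k"
proof
  \<comment> \<open>Below \<open>p 0\<close> no \<open>k\<close> qualifies, and \<open>y j\<close>
    is \<open>False\<close> there.\<close>
  define y where "y j = (\<exists>k. p k \<le> j \<and> j < p (Suc k) \<and> bit (z k) (j - p k))" for j
  fix k
  have y: "y (p k + i) = bit (z k) i" if "i < p (Suc k) - p k" for i
  proof -
    have i: "p k \<le> p k + i" "p k + i < p (Suc k)" using that by auto
    have "k' = k" if "p k' \<le> p k + i" "p k + i < p (Suc k')" for k'
      using interval_partition_unique[OF assms(1) that i] .
    with i show ?thesis unfolding y_def by (metis diff_add_inverse)
  qed
  have "bit (z k) i \<Longrightarrow> i < p (Suc k) - p k" for i
    using less_power_bitD[OF assms(2)] .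
  with y show "segment (p k) (p (Suc k) - p k) y = z k"
    by (auto intro!: bit_eqI simp: bit_segment)
qed

section \<open>Cylinders, closed sets and their measure\<close>

lemma continuous_on_segment: "continuous_on UNIV (segment n l)"
proof -
  have "continuous_on UNIV (\<lambda>y :: nat \<Rightarrow> bool. of_bool (y (n + i)) :: nat)" for i
    using continuous_on_compose2[of UNIV "of_bool :: bool \<Rightarrow> nat" UNIV "\<lambda>y. y (n + i)"]
    by (simp add: continuous_on_discrete continuous_on_product_coordinates)
  then show ?thesis
    unfolding segment_def by (intro continuous_intros)
qed

lemma closed_segment_vimage: "closed (segment n l -` J)"
  using continuous_on_segment by (intro closed_vimage) (simp_all only: closed_def discrete_topology_class.open_discrete)

lemma segment_vimage_measurable: "segment n l -` J \<in> sets cantor_measure"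
  by (simp add: sets_cantor_measure closed_segment_vimage)

interpretation cantor: product_prob_space "\<lambda>_ :: nat. measure_pmf (bernoulli_pmf (1/2))" UNIV
  by unfold_locales

lemma finite_cantor_measure: "finite_measure cantor_measure"
  unfolding cantor_measure_def by unfold_locales

lemma emeasure_cylinder:
  assumes "t < 2 ^ m"
  shows "emeasure cantor_measure (segment 0 m -` {t}) = (1/2) ^ m"
proof -
  \<comment> \<open>The bits of \<open>t\<close> from \<open>m\<close> on vanish, so the cylinder is
    a condition on the first \<open>m\<close> coordinates alone, which are independent fair coin
    tosses.\<close>
  have "segment 0 m -` {t} = {y. \<forall>i\<in>{..<m}. y i \<in> {bit t i}}"
  proof -
    have "bit t i \<Longrightarrow> i < m" for i
      using less_power_bitD[OF assms] .
    then show ?thesis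
      by (fastforce simp: bit_eq_iff bit_segment)
  qed
  also have "emeasure cantor_measure \<dots> =
      (\<Prod>i<m. emeasure (measure_pmf (bernoulli_pmf (1/2))) {bit t i})"
    using cantor.emeasure_PiM_Collect[of "{..<m}" "\<lambda>i. {bit t i}"]
    by (simp add: cantor_measure_def space_PiM)
  also have "\<dots> = (\<Prod>i<m. 1/2)"
  proof (rule prod.cong[OF refl])
    fix i
    have "ennreal (1/2) = 1/2"
      by (metis divide_ennreal ennreal_1 ennreal_numeral zero_le_numeral zero_less_numeral zero_le_one)
    then show "emeasure (measure_pmf (bernoulli_pmf (1/2))) {bit t i} = 1/2"
      by (cases "bit t i") (simp_all add: emeasure_pmf_single)
  qed
  finally show ?thesis by simp
qed

lemma measure_segment_vimage:
  assumes "T \<subseteq> {..<2 ^ m}"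
  shows "measure cantor_measure (segment 0 m -` T) = card T / 2 ^ m"
proof -
  interpret finite_measure cantor_measure by (rule finite_cantor_measure)
  have "measure cantor_measure (segment 0 m -` {t}) = (1/2) ^ m" if "t \<in> T" for t
  proof -
    have "ennreal ((1/2) ^ m) = (1/2) ^ m"
      by (metis divide_ennreal ennreal_1 ennreal_numeral ennreal_power zero_le_numeral zero_less_numeral zero_le_one zero_le_divide_1_iff)
    then show ?thesis
      using emeasure_cylinder[of t m] that assms by (intro measure_eq_emeasure_eq_ennreal) auto
  qed
  moreover have "segment 0 m -` T = (\<Union>t\<in>T. segment 0 m -` {t})" by auto
  moreover have "measure cantor_measure (\<Union>t\<in>T. segment 0 m -` {t}) =
      (\<Sum>t\<in>T. measure cantor_measure (segment 0 m -` {t}))"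
    using assms by (intro finite_measure_finite_Union)
      (auto simp: finite_subset disjoint_family_on_def segment_vimage_measurable)
  ultimately show ?thesis by (simp add: power_divide)
qed

text \<open>A basic neighbourhood of \<open>y\<close> restricts only finitely many coordinates, so
  it contains every point that shares a long enough initial segment with \<open>y\<close>. If
  \<open>C\<close> always has such a point, then \<open>y\<close> is in the closure of
  \<open>C\<close>.\<close>

lemma closed_eq_INT_segments:
  assumes "closed C"
  shows "C = (\<Inter>m. segment 0 m -` segment 0 m ` C)"
proof (intro equalityI subsetI)
  fix y assume y: "y \<in> (\<Inter>m. segment 0 m -` segment 0 m ` C)"
  show "y \<in> C"
  proof (rule ccontr)
    assume "y \<notin> C"
    then obtain X where X: "y \<in> Pi\<^sub>E UNIV X" "finite {i. X i \<noteq> UNIV}" "Pi\<^sub>E UNIV X \<subseteq> - C"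
      using product_topology_open_contains_basis[of "\<lambda>_. euclidean" UNIV "- C" y] assms
      by (auto simp: euclidean_product_topology open_closed)
    obtain m where m: "\<And>i. X i \<noteq> UNIV \<Longrightarrow> i < m"
      using X(2) by (auto simp: finite_nat_set_iff_bounded)
    obtain x where "x \<in> C" "\<forall>i<m. y i = x i"
      using y by (auto simp: segment_eq_iff image_iff)
    have "y i \<in> X i" for i using X(1) by auto
    then have "x i \<in> X i" for i
    proof (cases "X i = UNIV")
      case False
      then have "x i = y i" using m[of i] \<open>\<forall>i<m. y i = x i\<close> by simp
      then show ?thesis using \<open>y i \<in> X i\<close> by (rule ssubst)
    qed simp
    then have "x \<in> Pi\<^sub>E UNIV X" by (simp add: PiE_UNIV_domain)
    then show False using X(3) \<open>x \<in> C\<close> by auto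
  qed
qed auto

text \<open>The cylinder sets over the initial segments of \<open>C\<close> decrease to
  \<open>C\<close>, and the measure is continuous from above.\<close>

lemma closed_segment_density:
  assumes "closed C"
  shows "(\<lambda>m. card (segment 0 m ` C) / 2 ^ m) \<longlonglongrightarrow> measure cantor_measure C"
proof -
  interpret finite_measure cantor_measure by (rule finite_cantor_measure)
  let ?A = "\<lambda>m. segment 0 m -` segment 0 m ` C"
  have "decseq ?A"
    by (rule decseq_SucI) (auto simp: segment_eq_iff image_iff intro: less_SucI)
  then have "(\<lambda>m. measure cantor_measure (?A m)) \<longlonglongrightarrow> measure cantor_measure (\<Inter>m. ?A m)"
    by (intro finite_Lim_measure_decseq) (auto simp: segment_vimage_measurable)
  then show ?thesis
    by (simp only: measure_segment_vimage[OF segment_image_subset] closed_eq_INT_segments[OF assms, symmetric])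
qed

lemma closed_null_iff:
  assumes "closed C"
  shows "C \<in> null_sets cantor_measure \<longleftrightarrow> measure cantor_measure C = 0"
proof -
  interpret finite_measure cantor_measure by (rule finite_cantor_measure)
  show ?thesis
    using assms by (auto simp: null_sets_def emeasure_eq_measure sets_cantor_measure)
qed

lemma closed_null_sparse:
  assumes "closed C" "C \<in> null_sets cantor_measure" "0 < K"
  obtains m where "N \<le> m" "card (segment 0 m ` C) * K \<le> 2 ^ m"
proof -
  have "(\<lambda>m. card (segment 0 m ` C) / 2 ^ m) \<longlonglongrightarrow> 0"
    using closed_segment_density[OF assms(1)] assms closed_null_iff by simp
  then have "\<forall>\<^sub>F m in sequentially. card (segment 0 m ` C) / 2 ^ m < 1 / real K"
    using \<open>0 < K\<close> by (intro order_tendstoD(2)) auto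
  then have "\<forall>\<^sub>F m in sequentially. N \<le> m \<and> card (segment 0 m ` C) / 2 ^ m < 1 / real K"
    using eventually_ge_at_top[of N] by eventually_elim simp
  then obtain m where m: "N \<le> m" "card (segment 0 m ` C) / 2 ^ m < 1 / real K"
    using eventually_happens'[OF sequentially_bot] by blast
  then have "real (card (segment 0 m ` C) * K) < real (2 ^ m)"
    using \<open>0 < K\<close> by (simp add: field_simps)
  then show ?thesis using m(1) that[of m] by linarith
qed

section \<open>Blocks of a partition and the ideal generated by the closed null sets\<close>

definition block :: "(nat \<Rightarrow> nat) \<Rightarrow> nat \<Rightarrow> (nat \<Rightarrow> bool) \<Rightarrow> nat" where
  "block p k = segment (p k) (p (Suc k) - p k)"

definition block_size :: "(nat \<Rightarrow> nat) \<Rightarrow> nat \<Rightarrow> nat" where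
  "block_size p k = 2 ^ (p (Suc k) - p k)"

lemma block_less: "block p k y < block_size p k"
  by (simp add: block_def block_size_def segment_less)

lemma block_cantor_add: "block p k (cantor_add x y) = xor (block p k x) (block p k y)"
  by (simp add: block_def segment_cantor_add)

lemma Union_in_E_ideal:
  assumes "\<And>n :: nat. closed (C n) \<and> C n \<in> null_sets cantor_measure"
  shows "(\<Union>n. C n) \<in> E_ideal"
  unfolding E_ideal_def hull_def
proof (intro InterI, clarify)
  fix I assume I: "sigma_ideal I" "{C. closed C \<and> C \<in> null_sets cantor_measure} \<subseteq> I"
  then have "range C \<subseteq> I" using assms by blast
  then show "(\<Union>n. C n) \<in> I" using I(1) by (simp add: sigma_ideal_def)
qed

text \<open>The sets covered by countably many closed null sets form a sigma-ideal containing the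
  generators, hence containing the hull.\<close>

lemma E_ideal_cover:
  assumes "A \<in> E_ideal"
  obtains C :: "nat \<Rightarrow> (nat \<Rightarrow> bool) set"
  where "\<And>n. closed (C n)" "\<And>n. C n \<in> null_sets cantor_measure" "incseq C" "A \<subseteq> (\<Union>n. C n)"
proof -
  let ?I = "{A. \<exists>C :: nat \<Rightarrow> _. (\<forall>n. closed (C n) \<and> C n \<in> null_sets cantor_measure) \<and> A \<subseteq> (\<Union>n. C n)}"
  have "sigma_ideal ?I"
    unfolding sigma_ideal_def
  proof (intro conjI ballI allI impI)
    show "{} \<in> ?I" by (auto intro!: exI[of _ "\<lambda>_. {}"])
  next
    fix A B assume "A \<in> ?I" "B \<subseteq> A"
    then show "B \<in> ?I" by blast
  next
    fix A :: "nat \<Rightarrow> (nat \<Rightarrow> bool) set" assume "range A \<subseteq> ?I"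
    then have "\<forall>k. \<exists>C :: nat \<Rightarrow> _. (\<forall>n. closed (C n) \<and> C n \<in> null_sets cantor_measure) \<and> A k \<subseteq> (\<Union>n. C n)"
      by blast
    then obtain C :: "nat \<Rightarrow> nat \<Rightarrow> _" where C:
      "\<And>k n. closed (C k n) \<and> C k n \<in> null_sets cantor_measure" "\<And>k. A k \<subseteq> (\<Union>n. C k n)"
      by metis
    define D where "D n = (case prod_decode n of (k, j) \<Rightarrow> C k j)" for n
    have "A k \<subseteq> (\<Union>n. D n)" for k
    proof
      fix y assume "y \<in> A k"
      then obtain j where "y \<in> C k j" using C(2)[of k] by blast
      then have "y \<in> D (prod_encode (k, j))" by (simp add: D_def)
      then show "y \<in> (\<Union>n. D n)" by blast
    qed
    then have "(\<Union>k. A k) \<subseteq> (\<Union>n. D n)" by (rule UN_least)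
    moreover have "\<forall>n. closed (D n) \<and> D n \<in> null_sets cantor_measure"
      using C(1) by (simp add: D_def split: prod.split)
    ultimately show "(\<Union>k. A k) \<in> ?I" by blast
  qed
  moreover have "{C. closed C \<and> C \<in> null_sets cantor_measure} \<subseteq> ?I"
  proof
    fix C assume "C \<in> {C. closed C \<and> C \<in> null_sets cantor_measure}"
    then show "C \<in> ?I" by (intro CollectI exI[of _ "\<lambda>_. C"]) auto
  qed
  ultimately have "E_ideal \<subseteq> ?I"
    unfolding E_ideal_def by (intro hull_minimal)
  then have "A \<in> ?I" using assms by (rule subsetD)
  then obtain C :: "nat \<Rightarrow> _" where C:
    "\<forall>n. closed (C n) \<and> C n \<in> null_sets cantor_measure" "A \<subseteq> (\<Union>n. C n)" by blast
  show ?thesis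
  \<comment> \<open>Finite unions of closed null sets are closed and null; they make the cover
    increasing.\<close>
  proof (rule that[of "\<lambda>n. \<Union>i\<le>n. C i"])
    show "closed (\<Union>i\<le>n. C i)" for n
      using C(1) by (intro closed_UN) auto
    show "(\<Union>i\<le>n. C i) \<in> null_sets cantor_measure" for n
      using C(1) by (intro null_sets.finite_UN) auto
    show "incseq (\<lambda>n. \<Union>i\<le>n. C i)"
      by (intro incseq_SucI UN_mono) auto
    show "A \<subseteq> (\<Union>n. \<Union>i\<le>n. C i)"
      using C(2) by blast
  qed
qed

text \<open>Block \<open>k\<close> takes care of the \<open>k\<close>-th set of an increasing closed
  null cover: \<open>p (Suc k)\<close> is chosen so late that few values of the block occur in that
  set. The growth conditions on the lengths serve to make the resulting \<open>F\<close> and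
  \<open>b\<close> strictly increasing.\<close>

lemma E_ideal_block_cover:
  assumes "A \<in> E_ideal"
  obtains p J where "strict_mono p"
    "\<And>k. k + 2 \<le> p (Suc k) - p k"
    "\<And>k. p (Suc k) - p k + 2 \<le> p (Suc (Suc k)) - p (Suc k)"
    "\<And>k. J k \<subseteq> {..<block_size p k}" "\<And>k. card (J k) = 2 ^ (p (Suc k) - p k - k)"
    "\<And>y. y \<in> A \<Longrightarrow> \<forall>\<^sub>\<infinity>k. block p k y \<in> J k"
proof -
  obtain C where C: "\<And>n. closed (C n)" "\<And>n. C n \<in> null_sets cantor_measure" "incseq C"
    "A \<subseteq> (\<Union>n. C n)"
    using E_ideal_cover[OF assms] by blast
  \<comment> \<open>Here \<open>m\<close> and \<open>m'\<close> stand for \<open>p k\<close> and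
    \<open>p (Suc k)\<close>. The factor \<open>2 ^ m\<close> pays for forgetting the first
    \<open>m\<close> coordinates, \<open>2 ^ k\<close> is the wanted density, and
    \<open>2 * m + 2\<close> makes each block longer than the previous one by at least 2.\<close>
  define Q where "Q k m m' \<longleftrightarrow> 2 * m + 2 \<le> m' \<and> card (segment 0 m' ` C k) * 2 ^ (m + k) \<le> 2 ^ m'" for k m m' :: nat
  have "\<exists>p. \<forall>k. k \<le> p k \<and> Q k (p k) (p (Suc k))"
  proof (rule dependent_nat_choice)
    fix m k :: nat assume "k \<le> m"
    obtain m' where "2 * m + 2 \<le> m'" "card (segment 0 m' ` C k) * 2 ^ (m + k) \<le> 2 ^ m'"
      using closed_null_sparse[OF C(1,2), of "2 ^ (m + k)"] by auto
    with \<open>k \<le> m\<close> show "\<exists>m'. Suc k \<le> m' \<and> Q k m m'"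
      unfolding Q_def by (intro exI[of _ m']) linarith
  qed auto
  then obtain p where p: "\<And>k. k \<le> p k" "\<And>k. Q k (p k) (p (Suc k))" by blast
  have p_step: "2 * p k + 2 \<le> p (Suc k)" for k using p(2) by (simp add: Q_def)
  \<comment> \<open>The set of values is padded to an exact size, because slaloms have prescribed
    cardinalities.\<close>
  have "\<exists>B. block p k ` C k \<subseteq> B \<and> B \<subseteq> {..<block_size p k} \<and> card B = 2 ^ (p (Suc k) - p k - k)" for k
  proof (rule exists_subset_between)
    have "card (block p k ` C k) * 2 ^ (p k + k) \<le> card (segment 0 (p (Suc k)) ` C k) * 2 ^ (p k + k)"
      using card_segment_tail[of "p k" "p (Suc k) - p k" "C k"] p_step[of k]
      by (simp add: block_def)
    also have "\<dots> \<le> 2 ^ p (Suc k)" using p(2) by (simp add: Q_def)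
    also have "\<dots> = 2 ^ (p (Suc k) - p k - k) * 2 ^ (p k + k)"
      using p_step[of k] p(1)[of k] by (simp flip: power_add)
    finally show "card (block p k ` C k) \<le> 2 ^ (p (Suc k) - p k - k)" by simp
    show "2 ^ (p (Suc k) - p k - k) \<le> card {..<block_size p k}"
      by (simp add: block_size_def)
    show "block p k ` C k \<subseteq> {..<block_size p k}" using block_less by auto
  qed simp
  then obtain J where J: "\<And>k. block p k ` C k \<subseteq> J k \<and> J k \<subseteq> {..<block_size p k} \<and>
      card (J k) = 2 ^ (p (Suc k) - p k - k)"
    by metis
  show ?thesis
  proof (rule that[of p J])
    show "strict_mono p"
      unfolding strict_mono_Suc_iff
    proof
      fix k show "p k < p (Suc k)" using p_step[of k] by simp
    qed
    show "k + 2 \<le> p (Suc k) - p k" for k using p_step[of k] p(1)[of k] by simp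
    show "p (Suc k) - p k + 2 \<le> p (Suc (Suc k)) - p (Suc k)" for k
      using p_step[of "Suc k"] p_step[of k] by simp
    show "J k \<subseteq> {..<block_size p k}" "card (J k) = 2 ^ (p (Suc k) - p k - k)" for k
      using J by blast+
    fix y assume "y \<in> A"
    then obtain n where "y \<in> C n" using C(4) by blast
    \<comment> \<open>Since the cover increases, \<open>y\<close> stays in \<open>C k\<close> for
      all later \<open>k\<close>.\<close>
    then have "block p k y \<in> J k" if "n \<le> k" for k
      using J[of k] incseqD[OF C(3) that] by blast
    then show "\<forall>\<^sub>\<infinity>k. block p k y \<in> J k" by (auto simp: MOST_nat_le)
  qed
qed

text \<open>The factors \<open>(n + 1) / (n + 2)\<close> telescope to \<open>(k + 1) / (k + j + 1)\<close>.\<close>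

lemma null_if_blocks_sparse:
  assumes "strict_mono p" "closed C" "\<And>n. k \<le> n \<Longrightarrow> block p n ` C \<subseteq> J n"
    "\<And>n. finite (J n)" "\<And>n. card (J n) * (n + 2) \<le> block_size p n * (n + 1)"
  shows "C \<in> null_sets cantor_measure"
proof -
  let ?c = "\<lambda>m. card (segment 0 m ` C)"
  \<comment> \<open>Density bound without division: it is at most 1 at level \<open>p k\<close>, as
    the earlier blocks are unrestricted, and block \<open>n\<close> multiplies it by at most
    \<open>(n + 1) / (n + 2)\<close>.\<close>
  have count: "?c (p (k + j)) * (k + j + 1) \<le> 2 ^ p (k + j) * (k + 1)" for j
  proof (induction j)
    case 0
    have "?c (p k) \<le> 2 ^ p k"
      using card_mono[OF _ segment_image_subset[of 0 "p k" C]] by simp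
    then have "?c (p k) * (k + 1) \<le> 2 ^ p k * (k + 1)" by (rule mult_le_mono1)
    then show ?case by simp
  next
    case (Suc j)
    let ?n = "k + j"
    have lt: "p ?n < p (Suc ?n)" using assms(1) by (simp add: strict_mono_Suc_iff)
    have "?c (p (Suc ?n)) \<le> ?c (p ?n) * card (block p ?n ` C)"
      using card_segment_append[of "p ?n" "p (Suc ?n) - p ?n" C] lt by (simp add: block_def)
    also have "\<dots> \<le> ?c (p ?n) * card (J ?n)"
      using assms(3)[of ?n] assms(4) by (simp add: card_mono)
    finally have "?c (p (Suc ?n)) * (?n + 2) \<le> ?c (p ?n) * (card (J ?n) * (?n + 2))"
      by (metis mult.assoc mult_le_mono1)
    also have "\<dots> \<le> ?c (p ?n) * (block_size p ?n * (?n + 1))"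
      using assms(5) by (intro mult_le_mono2)
    also have "\<dots> = block_size p ?n * (?c (p ?n) * (?n + 1))" by (simp only: mult_ac)
    also have "\<dots> \<le> block_size p ?n * (2 ^ p ?n * (k + 1))"
      using Suc.IH by (intro mult_le_mono2)
    also have "\<dots> = 2 ^ p (Suc ?n) * (k + 1)"
    proof -
      have "block_size p ?n * 2 ^ p ?n = 2 ^ p (Suc ?n)"
        using lt by (simp add: block_size_def flip: power_add)
      then show ?thesis by (simp only: mult.assoc[symmetric])
    qed
    finally show ?case by simp
  qed
  \<comment> \<open>Along the levels \<open>p (k + j)\<close> the densities still converge to the
    measure of \<open>C\<close>, which is therefore 0.\<close>
  have "strict_mono (\<lambda>j. p (k + j))"
    using assms(1) by (simp add: strict_mono_def)
  then have "(\<lambda>j. ?c (p (k + j)) / 2 ^ p (k + j)) \<longlonglongrightarrow> measure cantor_measure C"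
    using LIMSEQ_subseq_LIMSEQ[OF closed_segment_density[OF assms(2)]] by (simp add: o_def)
  moreover have "(\<lambda>j. ?c (p (k + j)) / 2 ^ p (k + j)) \<longlonglongrightarrow> 0"
  proof (rule tendsto_sandwich[of "\<lambda>_. 0" _ _ "\<lambda>j. real (k + 1) / real (k + j + 1)"])
    have "?c (p (k + j)) / 2 ^ p (k + j) \<le> real (k + 1) / real (k + j + 1)" for j
    proof -
      have "real (?c (p (k + j))) * real (k + j + 1) \<le> 2 ^ p (k + j) * real (k + 1)"
        using count[of j] by (metis of_nat_le_iff of_nat_mult of_nat_numeral of_nat_power)
      then show ?thesis by (simp add: field_simps)
    qed
    then show "\<forall>\<^sub>F j in sequentially. ?c (p (k + j)) / 2 ^ p (k + j) \<le> real (k + 1) / real (k + j + 1)"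
      by simp
    show "(\<lambda>j. real (k + 1) / real (k + j + 1)) \<longlonglongrightarrow> 0"
      by real_asymp
  qed auto
  ultimately show ?thesis
    using closed_null_iff[OF assms(2)] LIMSEQ_unique by blast
qed

text \<open>Splitting by the index from which all blocks obey \<open>J\<close> gives countably many
  closed sets, each null by the previous lemma.\<close>

lemma E_ideal_blocks:
  assumes "strict_mono p" "\<And>n. finite (J n)" "\<And>n. card (J n) * (n + 2) \<le> block_size p n * (n + 1)"
  shows "{y. \<forall>\<^sub>\<infinity>n. block p n y \<in> J n} \<in> E_ideal"
proof -
  let ?C = "\<lambda>k. \<Inter>n\<in>{k..}. block p n -` J n"
  have "closed (?C k) \<and> ?C k \<in> null_sets cantor_measure" for k
  proof
    show "closed (?C k)" by (intro closed_INT) (simp add: block_def closed_segment_vimage)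
    then show "?C k \<in> null_sets cantor_measure"
      using assms by (intro null_if_blocks_sparse[of p _ k J]) auto
  qed
  then have "(\<Union>k. ?C k) \<in> E_ideal" by (rule Union_in_E_ideal)
  moreover have "{y. \<forall>\<^sub>\<infinity>n. block p n y \<in> J n} = (\<Union>k. ?C k)"
    by (auto simp: MOST_nat_le)
  ultimately show ?thesis by simp
qed

text \<open>A bad translate has the form \<open>xor a s\<close> with \<open>a\<close> in
  \<open>K\<close> and \<open>s\<close> in \<open>S\<close>, and there are too few such pairs to
  exhaust all values.\<close>

lemma xor_translate_avoids:
  fixes S K :: "nat set"
  assumes "finite S" "finite K" "card K * card S < 2 ^ l"
  obtains t where "t < 2 ^ l" "\<And>s. s \<in> S \<Longrightarrow> xor s t \<notin> K"
proof -
  let ?D = "(\<lambda>(a, s). xor a s) ` (K \<times> S)"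
  have "card ?D < card {..<(2 :: nat) ^ l}"
    using assms card_image_le[of "K \<times> S" "\<lambda>(a, s). xor a s"] by (simp add: card_cartesian_product)
  then have "\<not> {..<2 ^ l} \<subseteq> ?D"
    using assms by (meson card_mono finite_SigmaI finite_imageI not_le)
  then obtain t where t: "t < 2 ^ l" "t \<notin> ?D" by auto
  have "xor s t \<notin> K" if "s \<in> S" for s
  proof
    assume "xor s t \<in> K"
    moreover have "t = xor (xor s t) s" by (rule bit_eqI) (auto simp: bit_xor_iff)
    ultimately have "t \<in> ?D" using that by (metis (mono_tags) SigmaI case_prod_conv imageI)
    then show False using t by simp
  qed
  then show ?thesis using t that by blast
qed

section \<open>Cardinal invariants as attained minima\<close>

lemma dominating_number_le:
  assumes "Z \<subseteq> Y" "\<And>x. x \<in> X \<Longrightarrow> \<exists>y\<in>Z. R x y"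
  shows "dominating_number X R Y \<le>o |Z|"
  unfolding dominating_number_def using assms by (intro card_Min_le) (auto simp: card_of_Card_order)

lemma dominating_number_attained:
  assumes "\<And>x. x \<in> X \<Longrightarrow> \<exists>y\<in>Y. R x y"
  obtains Z where "Z \<subseteq> Y" "\<And>x. x \<in> X \<Longrightarrow> \<exists>y\<in>Z. R x y" "dominating_number X R Y = |Z|"
proof -
  have "dominating_number X R Y \<in> {card_of Z | Z. Z \<subseteq> Y \<and> (\<forall>x\<in>X. \<exists>y\<in>Z. R x y)}"
    unfolding dominating_number_def using assms by (intro card_Min_in) (auto simp: card_of_Card_order)
  then show ?thesis using that by auto
qed

text \<open>Only \<open>b 0\<close> can be 0, since \<open>b\<close> is strictly increasing; a
  failure at index 0 does not affect \<open>\<in>\<^sup>*\<close>.\<close>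

lemma Slm_covers:
  assumes "strict_mono b" "b \<le> F" "x \<in> Pi_below F"
  shows "\<exists>S\<in>Slm F b. x \<in>\<^sup>* S"
proof -
  have "\<exists>B. (if b n = 0 then {} else {x n}) \<subseteq> B \<and> B \<subseteq> {..<F n} \<and> card B = b n" for n
    using assms(2,3) by (intro exists_subset_between) (auto simp: le_fun_def Pi_below_def)
  then obtain S where S: "\<And>n. (if b n = 0 then {} else {x n}) \<subseteq> S n \<and> S n \<subseteq> {..<F n} \<and> card (S n) = b n"
    by metis
  have "x n \<in> S n" if "1 \<le> n" for n
    using S[of n] strict_mono_imp_increasing[OF assms(1), of n] that by (auto split: if_splits)
  then have "x \<in>\<^sup>* S" by (auto simp: in_star_def MOST_nat_le)
  with S show ?thesis by (auto simp: Slm_def)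
qed

lemma Slm_dominating_number_attained:
  assumes "strict_mono b" "b \<le> F"
  obtains Z where "Z \<subseteq> Slm F b" "\<And>x. x \<in> Pi_below F \<Longrightarrow> \<exists>S\<in>Z. x \<in>\<^sup>* S"
    "dominating_number (Pi_below F) (\<in>\<^sup>*) (Slm F b) = |Z|"
  using dominating_number_attained[of "Pi_below F" "Slm F b" "(\<in>\<^sup>*)"] Slm_covers[OF assms] by metis

lemma non_le: "X \<notin> I \<Longrightarrow> non I \<le>o |X|"
  unfolding non_def by (intro card_Min_le) (auto simp: card_of_Card_order)

lemma non_attained:
  assumes "X \<notin> I"
  obtains Y where "Y \<notin> I" "non I = |Y|"
proof -
  have "non I \<in> {card_of X | X. X \<notin> I}"
    unfolding non_def using assms by (intro card_Min_in) (auto simp: card_of_Card_order)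
  then show ?thesis using that by auto
qed

section \<open>Passing between localizing families and sets outside \<open>E_star\<close>\<close>

lemma blocks_in_Pi_below: "(\<lambda>k. block p k y) \<in> Pi_below (block_size p)"
  by (simp add: Pi_below_def block_less)

lemma exists_blocks:
  assumes "strict_mono p" "z \<in> Pi_below (block_size p)"
  obtains y where "\<And>k. block p k y = z k"
  using exists_segments[of p z] assms by (auto simp: Pi_below_def block_def block_size_def)

text \<open>Each slalom \<open>S\<close> gets one point whose translation moves every
  \<open>S k\<close> into \<open>J k\<close>; all \<open>z\<close> localized by \<open>S\<close> are
  thereby moved into the same set of the ideal.\<close>

lemma not_E_star_of_localization:
  assumes "strict_mono p" "\<And>k. (k + 1) * (k + 2) < block_size p k"
    and Z: "Z \<subseteq> Slm (block_size p) Suc" "\<And>x. x \<in> Pi_below (block_size p) \<Longrightarrow> \<exists>S\<in>Z. x \<in>\<^sup>* S"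
  obtains X where "X \<notin> E_star" "|X| \<le>o |Z|"
proof -
  \<comment> \<open>\<open>{..q k}\<close> is the set \<open>K\<^sub>k\<close> of the introduction.\<close>
  define q where "q k = block_size p k div (k + 2)" for k
  define J where "J k = {q k<..<block_size p k}" for k
  let ?E = "{y. \<forall>\<^sub>\<infinity>k. block p k y \<in> J k}"
  have E: "?E \<in> E_ideal"
  proof (rule E_ideal_blocks[OF assms(1)])
    fix k
    show "finite (J k)" by (simp add: J_def)
    \<comment> \<open>The removed set \<open>{..q k}\<close> has \<open>q k + 1\<close> elements,
      more than the fraction \<open>1 / (k + 2)\<close> of the block values.\<close>
    have "block_size p k < (q k + 1) * (k + 2)"
      using dividend_less_div_times[of "k + 2" "block_size p k"] by (simp add: q_def algebra_simps)
    then have "(block_size p k - Suc (q k)) * (k + 2) \<le> block_size p k * (k + 2) - block_size p k"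
      unfolding diff_mult_distrib by (intro diff_le_mono2) simp
    then show "card (J k) * (k + 2) \<le> block_size p k * (k + 1)"
      by (simp add: J_def)
  qed
  have "\<exists>x. \<forall>k. \<forall>s\<in>S k. xor s (block p k x) \<in> J k" if S: "S \<in> Z" for S
  proof -
    have Sk: "S k \<subseteq> {..<block_size p k}" "card (S k) = Suc k" for k
      using S Z(1) by (auto simp: Slm_def)
    have "\<exists>t < block_size p k. \<forall>s\<in>S k. xor s t \<notin> {..q k}" for k
    proof -
      let ?F = "block_size p k"
      \<comment> \<open>After multiplying by \<open>k + 2\<close>, the hypothesis on
        \<open>block_size p k\<close> absorbs the extra 1 in \<open>q k + 1\<close>.\<close>
      have "(q k + 1) * (k + 1) * (k + 2) = q k * (k + 2) * (k + 1) + (k + 1) * (k + 2)"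
        by (simp add: algebra_simps)
      also have "\<dots> < ?F * (k + 1) + ?F"
        using assms(2)[of k] div_times_less_eq_dividend[of ?F "k + 2"]
        by (intro add_le_less_mono mult_le_mono1) (simp_all only: q_def)
      also have "\<dots> = ?F * (k + 2)" by simp
      finally have "(q k + 1) * (k + 1) < ?F"
        by (simp only: mult_less_cancel2)
      then have "card {..q k} * card (S k) < 2 ^ (p (Suc k) - p k)"
        by (simp add: Sk(2) block_size_def)
      moreover have "finite (S k)" using Sk(1) finite_subset by blast
      ultimately obtain t where "t < 2 ^ (p (Suc k) - p k)" "\<And>s. s \<in> S k \<Longrightarrow> xor s t \<notin> {..q k}"
        using xor_translate_avoids[of "S k" "{..q k}"] by blast
      then show ?thesis unfolding block_size_def by blast
    qed
    then obtain t where t: "\<And>k. t k < block_size p k" "\<And>k s. s \<in> S k \<Longrightarrow> xor s (t k) \<notin> {..q k}"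
      by metis
    obtain x where x: "\<And>k. block p k x = t k"
      using exists_blocks[OF assms(1), of t] t(1) by (auto simp: Pi_below_def)
    have "xor s (t k) \<in> J k" if "s \<in> S k" for s k
    proof -
      have "s < block_size p k" using Sk(1) that by blast
      then have "xor s (t k) < block_size p k"
        using t(1)[of k] unfolding block_size_def by (rule xor_less)
      then show ?thesis using t(2)[OF that] by (simp add: J_def)
    qed
    then show ?thesis by (intro exI[of _ x]) (simp add: x)
  qed
  then obtain f where f: "\<And>S k s. S \<in> Z \<Longrightarrow> s \<in> S k \<Longrightarrow> xor s (block p k (f S)) \<in> J k"
    by metis
  have "z \<in> cantor_set_add (f ` Z) ?E" for z
  proof -
    obtain S where S: "S \<in> Z" "(\<lambda>k. block p k z) \<in>\<^sup>* S"
      using Z(2)[OF blocks_in_Pi_below] by blast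
    have "\<forall>\<^sub>\<infinity>k. block p k (cantor_add z (f S)) \<in> J k"
      using S(2) unfolding in_star_def block_cantor_add
      by (rule eventually_mono) (rule f[OF S(1)])
    \<comment> \<open>Every point is its own inverse.\<close>
    moreover have "z = cantor_add (f S) (cantor_add z (f S))"
      by (auto simp: cantor_add_def)
    ultimately show ?thesis using S(1) by (auto simp: cantor_set_add_def)
  qed
  then have "cantor_set_add (f ` Z) ?E = UNIV" by blast
  then have "f ` Z \<notin> E_star" using E by (auto simp: E_star_def)
  then show ?thesis using that card_of_image by blast
qed

text \<open>The pair \<open>F\<close>, \<open>b\<close> comes from a set of the ideal witnessing
  that \<open>X\<close> is not in \<open>E_star\<close>. Each \<open>x\<close> in \<open>X\<close>
  contributes one slalom, so the family has size at most \<open>|X|\<close>.\<close>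

lemma localization_of_not_E_star:
  assumes "X \<notin> E_star"
  obtains F b where "strict_mono F" "strict_mono b" "\<And>n. 1 \<le> F n" "b \<le> F"
    "summable (\<lambda>n. real (b n) / real (F n))"
    "dominating_number (Pi_below F) (\<in>\<^sup>*) (Slm F b) \<le>o |X|"
proof -
  obtain E where E: "E \<in> E_ideal" "cantor_set_add X E = UNIV"
    using assms by (auto simp: E_star_def)
  obtain p J where p: "strict_mono p"
    and large: "\<And>k. k + 2 \<le> p (Suc k) - p k"
    and grow: "\<And>k. p (Suc k) - p k + 2 \<le> p (Suc (Suc k)) - p (Suc k)"
    and J: "\<And>k. J k \<subseteq> {..<block_size p k}" "\<And>k. card (J k) = 2 ^ (p (Suc k) - p k - k)"
    and EJ: "\<And>y. y \<in> E \<Longrightarrow> \<forall>\<^sub>\<infinity>k. block p k y \<in> J k"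
    using E_ideal_block_cover[OF E(1)] by blast
  \<comment> \<open>The exact size of \<open>J k\<close>, that is \<open>block_size p k\<close>
    divided by \<open>2 ^ k\<close>.\<close>
  define b where "b k = (2 :: nat) ^ (p (Suc k) - p k - k)" for k
  let ?F = "block_size p"
  define S where "S x k = xor (block p k x) ` J k" for x k
  have "S x \<in> Slm ?F b" for x
  proof -
    have "S x k \<subseteq> {..<?F k}" for k
    proof -
      have "xor (block p k x) j < ?F k" if "j \<in> J k" for j
        using that J(1)[of k] block_less[of p k x] unfolding block_size_def
        by (intro xor_less) auto
      then show ?thesis by (auto simp: S_def)
    qed
    moreover have "card (S x k) = b k" for k
    proof -
      have "xor a (xor a j) = j" for a j :: nat
        by (rule bit_eqI) (auto simp: bit_xor_iff)
      then have "inj_on (xor (block p k x)) (J k)" by (metis inj_onI)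
      then show ?thesis by (simp add: S_def card_image J(2) b_def)
    qed
    ultimately show ?thesis by (simp add: Slm_def)
  qed
  then have sub: "S ` X \<subseteq> Slm ?F b" by blast
  have dom: "\<exists>T\<in>S ` X. z \<in>\<^sup>* T" if "z \<in> Pi_below ?F" for z
  proof -
    obtain y where y: "\<And>k. block p k y = z k" using exists_blocks[OF p \<open>z \<in> Pi_below ?F\<close>] by metis
    have "y \<in> cantor_set_add X E" using E(2) by simp
    then obtain x e where "x \<in> X" "e \<in> E" "y = cantor_add x e"
      by (auto simp: cantor_set_add_def)
    then have "\<forall>\<^sub>\<infinity>k. z k \<in> S x k"
      using EJ[OF \<open>e \<in> E\<close>] by (auto simp: S_def block_cantor_add simp flip: y elim!: eventually_mono)
    then show ?thesis using \<open>x \<in> X\<close> by (auto simp: in_star_def)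
  qed
  have "dominating_number (Pi_below ?F) (\<in>\<^sup>*) (Slm ?F b) \<le>o |S ` X|"
    using sub dom by (rule dominating_number_le)
  then have "dominating_number (Pi_below ?F) (\<in>\<^sup>*) (Slm ?F b) \<le>o |X|"
    by (rule ordLeq_transitive[OF _ card_of_image])
  moreover have "real (b k) / real (?F k) = (1/2) ^ k" for k
  proof -
    have "?F k = b k * 2 ^ k"
      using large[of k] by (simp add: block_size_def b_def flip: power_add)
    then show ?thesis by (simp add: b_def power_divide)
  qed
  then have "summable (\<lambda>n. real (b n) / real (?F n))"
    by (simp add: summable_geometric)
  moreover have "strict_mono ?F"
    unfolding strict_mono_Suc_iff block_size_def
  proof
    fix k show "(2 :: nat) ^ (p (Suc k) - p k) < 2 ^ (p (Suc (Suc k)) - p (Suc k))"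
      using grow[of k] by (intro power_strict_increasing) auto
  qed
  moreover have "strict_mono b"
    unfolding strict_mono_Suc_iff b_def
  proof
    \<comment> \<open>The block length grows by at least 2 while the subtracted index grows by
      1.\<close>
    fix k show "(2 :: nat) ^ (p (Suc k) - p k - k) < 2 ^ (p (Suc (Suc k)) - p (Suc k) - Suc k)"
      using grow[of k] large[of k] by (intro power_strict_increasing) auto
  qed
  moreover have "b \<le> ?F" by (simp add: le_fun_def b_def block_size_def del: diff_diff_left)
  moreover have "1 \<le> ?F k" for k by (simp add: block_size_def)
  ultimately show ?thesis using that by blast
qed

theorem theorem4p6:
  shows "(non E_star \<le>o
           card_Sup {dominating_number (Pi_below F) (\<in>\<^sup>*) (Slm F b) | F b.
             strict_mono F \<and> strict_mono b \<and> (\<forall>n. 1 \<le> F n) \<and> b \<le> F})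
       \<and>
         (card_Min {dominating_number (Pi_below F) (\<in>\<^sup>*) (Slm F b) | F b.
             strict_mono F \<and> strict_mono b \<and> (\<forall>n. 1 \<le> F n) \<and> b \<le> F \<and>
             summable (\<lambda>n. real (b n) / real (F n))}
           \<le>o non E_star)"
    (is "_ \<le>o card_Sup ?R \<and> card_Min ?R' \<le>o _")
proof -
  \<comment> \<open>Blocks of length \<open>2 * (k + 1)\<close>, so that \<open>?F k\<close> is
    \<open>4 ^ (k + 1)\<close>.\<close>
  define p :: "nat \<Rightarrow> nat" where "p k = k * (k + 1)" for k
  let ?F = "block_size p"
  have len: "p (Suc k) - p k = 2 * (k + 1)" for k by (simp add: p_def)
  then have F: "?F k = 4 ^ (k + 1)" for k by (simp add: block_size_def power_mult)
  have p: "strict_mono p" by (simp add: strict_mono_Suc_iff p_def)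
  have pow: "k + 1 < 2 ^ (k + 1)" for k :: nat by (rule less_exp)
  have big: "(k + 1) * (k + 2) < ?F k" for k
  proof -
    have "(k + 1) * (k + 2) < 2 ^ (k + 1) * 2 ^ (k + 1)"
      using pow[of k] by (intro mult_less_le_imp_less) auto
    also have "\<dots> = ?F k" by (simp add: F flip: power_mult_distrib)
    finally show ?thesis .
  qed
  have Suc_le: "Suc \<le> ?F"
  proof (rule le_funI)
    fix k show "Suc k \<le> ?F k" using big[of k] by simp
  qed
  obtain Z where Z: "Z \<subseteq> Slm ?F Suc" "\<And>x. x \<in> Pi_below ?F \<Longrightarrow> \<exists>S\<in>Z. x \<in>\<^sup>* S"
    "dominating_number (Pi_below ?F) (\<in>\<^sup>*) (Slm ?F Suc) = |Z|"
    using Slm_dominating_number_attained[OF _ Suc_le] by (auto simp: strict_mono_Suc_iff)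
  obtain X where X: "X \<notin> E_star" "|X| \<le>o |Z|"
    using not_E_star_of_localization[OF p big Z(1,2)] by blast
  \<comment> \<open>Each of these minima is attained, hence is a genuine cardinal.\<close>
  have card: "Card_order r" if R: "r \<in> ?R" for r
  proof -
    obtain F b where "strict_mono b" "b \<le> F"
      and r: "r = dominating_number (Pi_below F) (\<in>\<^sup>*) (Slm F b)"
      using R by blast
    then obtain Z where "r = |Z|" using Slm_dominating_number_attained by metis
    then show ?thesis by (simp add: card_of_Card_order)
  qed
  have "strict_mono ?F" "strict_mono Suc" "\<forall>k. 1 \<le> ?F k"
    by (simp_all add: strict_mono_Suc_iff F)
  \<comment> \<open>A bound by a single member is enough for the supremum.\<close>
  then have "|Z| \<in> ?R" unfolding Z(3)[symmetric] using Suc_le by blast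
  then have "|Z| \<le>o card_Sup ?R" using card by (intro card_Sup_upper)
  then have "non E_star \<le>o card_Sup ?R"
    by (rule ordLeq_transitive[OF ordLeq_transitive[OF non_le[OF X(1)] X(2)]])
  moreover have "card_Min ?R' \<le>o non E_star"
  proof -
    \<comment> \<open>The set \<open>X\<close> from the first half shows that the minimum defining
      \<open>non E_star\<close> is over a nonempty family; \<open>Y\<close> attains it.\<close>
    obtain Y where Y: "Y \<notin> E_star" "non E_star = |Y|" using non_attained[OF X(1)] by blast
    obtain F b where Fb: "strict_mono F" "strict_mono b" "\<And>n. 1 \<le> F n" "b \<le> F"
      "summable (\<lambda>n. real (b n) / real (F n))"
      "dominating_number (Pi_below F) (\<in>\<^sup>*) (Slm F b) \<le>o |Y|"
      using localization_of_not_E_star[OF Y(1)] by blast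
    then have in_R': "dominating_number (Pi_below F) (\<in>\<^sup>*) (Slm F b) \<in> ?R'" by blast
    have "?R' \<subseteq> ?R" by blast
    with in_R' have "card_Min ?R' \<le>o dominating_number (Pi_below F) (\<in>\<^sup>*) (Slm F b)"
      using card by (intro card_Min_le[OF _ _ in_R']) blast+
    then show ?thesis using Fb(6) unfolding Y(2) by (rule ordLeq_transitive)
  qed
  ultimately show ?thesis by blast
qed

end
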